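(* Let $A\subseteq\mathbb{R}$ be an open invex set with respect to $\eta:A\times A\to\mathbb{R}$, and let $a,b\in A$ with $a<a+\eta(b,a)$. Suppose that $f:A\to\mathbb{R}$ is a differentiable function such that $f'\in L[a,a+\eta(b,a)]$. Suppose that $|f'|^{q}$ is prequasiinvex on $A$ with respect to $\eta$ for some fixed $q>1$, and let $p$ be defined by $\frac1p+\frac1q=1$. Then for every $\alpha\in[0,1]$, $$\left|\frac{f(a)+f(a+\eta(b,a))}{2}-\frac{\Gamma(\alpha+1)}{2\,\eta(b,a)^{\alpha}}\left[J_{a^{+}}^{\alpha}f\big(a+\eta(b,a)\big)+J_{(a+\eta(b,a))^{-}}^{\alpha}f(a)\right]\right|\le\frac{\eta(b,a)}{2(\alpha p+1)^{1/p}}\left(\max\{|f'(a)|^{q},|f'(b)|^{q}\}\right)^{1/q}.$$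
   Context: A set $A\subseteq\mathbb{R}$ is invex with respect to $\eta:A\times A\to\mathbb{R}$ if $x+t\eta(y,x)\in A$ for all $x,y\in A$ and $t\in[0,1]$. A function $g:A\to\mathbb{R}$ on an invex set $A$ is prequasiinvex with respect to $\eta$ if $g(x+t\eta(y,x))\le\max\{g(x),g(y)\}$ for all $x,y\in A$ and $t\in[0,1]$. $L[c,d]$ denotes the Lebesgue integrable functions on $[c,d]$ (for a function with larger domain, its restriction is meant). For $f\in L[c,d]$ and $\alpha>0$ the Riemann–Liouville fractional integrals are $$J_{c^{+}}^{\alpha}f(x)=\frac{1}{\Gamma(\alpha)}\int_c^x (x-t)^{\alpha-1}f(t)\,dt\ (x>c),\qquad J_{d^{-}}^{\alpha}f(x)=\frac{1}{\Gamma(\alpha)}\int_x^d (t-x)^{\alpha-1}f(t)\,dt\ (x<d),$$ where $\Gamma$ is the Gamma function, and for $\alpha=0$ one sets $J_{c^{+}}^{0}f(x)=J_{d^{-}}^{0}f(x)=f(x)$. Here they are used with $c=a$ and $d=a+\eta(b,a)$. *)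

theory Defs
  imports "HOL-Analysis.Analysis"
begin

(* Functions on A or on A \<times> A are rendered as total functions; only their values
   on A (respectively on A \<times> A) matter below. *)

definition invex_set :: "real set \<Rightarrow> (real \<Rightarrow> real \<Rightarrow> real) \<Rightarrow> bool" where
  "invex_set A \<eta> \<longleftrightarrow> (\<forall>x\<in>A. \<forall>y\<in>A. \<forall>t\<in>{0..1}. x + t * \<eta> y x \<in> A)"

definition prequasiinvex_on ::
  "real set \<Rightarrow> (real \<Rightarrow> real \<Rightarrow> real) \<Rightarrow> (real \<Rightarrow> real) \<Rightarrow> bool" where
  "prequasiinvex_on A \<eta> g \<longleftrightarrow>
     (\<forall>x\<in>A. \<forall>y\<in>A. \<forall>t\<in>{0..1}. g (x + t * \<eta> y x) \<le> max (g x) (g y))"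

(* Riemann-Liouville integrals of order \<alpha> \<ge> 0, for c < x and x < d respectively.
   The convention 0 powr r = 0 affects the integrands only at the single point t = x. *)

definition RL_left :: "real \<Rightarrow> real \<Rightarrow> (real \<Rightarrow> real) \<Rightarrow> real \<Rightarrow> real" where
  "RL_left c \<alpha> f x =
     (if \<alpha> = 0 then f x
      else 1 / Gamma \<alpha> * (LINT t:{c..x}|lebesgue. (x - t) powr (\<alpha> - 1) * f t))"

definition RL_right :: "real \<Rightarrow> real \<Rightarrow> (real \<Rightarrow> real) \<Rightarrow> real \<Rightarrow> real" where
  "RL_right d \<alpha> f x =
     (if \<alpha> = 0 then f x
      else 1 / Gamma \<alpha> * (LINT t:{x..d}|lebesgue. (t - x) powr (\<alpha> - 1) * f t))"

end

theory Submission
  imports Defs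
begin

text \<open>
  Prequasiinvexity along the segment from \<open>a\<close> to \<open>c = a + \<eta> b a\<close> bounds \<open>\<bar>deriv f\<bar>\<close> there by
  \<open>M = max (\<bar>deriv f a\<bar> powr q) (\<bar>deriv f b\<bar> powr q) powr (1 / q)\<close>, so \<open>f\<close> is \<open>M\<close>-Lipschitz on
  the segment. Reflecting one of the two fractional integrals writes the left-hand side as a
  multiple of the integral of \<open>(t - a) powr (\<alpha> - 1) * (f a + f c - f t - f (a + c - t))\<close>, where the
  last factor is at most \<open>2 * M * min (t - a) (c - t)\<close>. Evaluating the resulting integral gives
  the bound \<open>(c - a) * M / (2 * (\<alpha> + 1))\<close>, which by Bernoulli's inequality
  \<open>(\<alpha> * p + 1) powr (1 / p) \<le> \<alpha> + 1\<close> is at least as strong as the claim.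
\<close>

section \<open>Reflection and integrals of powers\<close>

lemma has_integral_reflect_Icc:
  fixes g :: "real \<Rightarrow> 'a::real_normed_vector"
  assumes "(g has_integral I) {a..b}"
  shows "((\<lambda>t. g (a + b - t)) has_integral I) {a..b}"
proof -
  have "((\<lambda>t. g (- t)) has_integral I) {-b..-a}"
    using assms by simp
  from has_integral_shift_real_ivl[OF this, of "- (a + b)"]
  show ?thesis by (simp add: algebra_simps)
qed

text \<open>The interior form of the fundamental theorem is used because for \<open>b = a\<close>
  and \<open>\<beta> < 1\<close> the antiderivative is continuous at \<open>a\<close> but has no
  finite derivative there.\<close>

lemma has_integral_powr_shift:
  fixes a b c \<beta> :: real
  assumes "a \<le> b" "b \<le> c" "\<beta> > 0"
  shows "((\<lambda>t. (t - a) powr (\<beta> - 1)) has_integral ((c - a) powr \<beta> / \<beta> - (b - a) powr \<beta> / \<beta>)) {b..c}"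
proof (rule fundamental_theorem_of_calculus_interior)
  show "continuous_on {b..c} (\<lambda>t. (t - a) powr \<beta> / \<beta>)"
    using assms by (intro continuous_intros continuous_on_powr') auto
  fix t assume "t \<in> {b<..<c}"
  then show "((\<lambda>t. (t - a) powr \<beta> / \<beta>) has_vector_derivative (t - a) powr (\<beta> - 1)) (at t)"
    using assms unfolding has_real_derivative_iff_has_vector_derivative[symmetric]
    by (auto intro!: derivative_eq_intros simp: powr_diff field_simps)
qed (use assms in auto)

text \<open>The minimum changes branch at the midpoint \<open>m\<close>, and on each half the
  integrand is a combination of powers of \<open>t - a\<close>. The two halves add up to the exact
  value \<open>(P - 2 * Q) / (\<alpha> * (\<alpha> + 1))\<close>, which is then estimated.\<close>

lemma integral_powr_times_min:
  fixes a b \<alpha> :: real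
  assumes "a < b" "0 < \<alpha>" "\<alpha> \<le> 1"
  shows "(\<lambda>t. (t - a) powr (\<alpha> - 1) * min (t - a) (b - t)) integrable_on {a..b}"
    and "integral {a..b} (\<lambda>t. (t - a) powr (\<alpha> - 1) * min (t - a) (b - t))
           \<le> (b - a) powr (\<alpha> + 1) / (2 * \<alpha> * (\<alpha> + 1))"
proof -
  define m where "m = (a + b) / 2"
  have m: "a \<le> m" "m \<le> b" and ma: "m - a = (b - a) / 2"
    using assms by (auto simp: m_def field_simps)
  define P where "P = (b - a) powr (\<alpha> + 1)"
  define Q where "Q = ((b - a) / 2) powr (\<alpha> + 1)"
  \<comment> \<open>This includes the endpoint \<open>u = 0\<close>, where both sides vanish since
    \<open>0 powr r = 0\<close>.\<close>
  have powr_Suc: "u powr \<alpha> = u powr (\<alpha> - 1) * u" if "u \<ge> 0" for u :: real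
    using powr_mult_base[OF that, of "\<alpha> - 1"] by (simp add: mult.commute)
  have left: "((\<lambda>t. (t - a) powr (\<alpha> - 1) * min (t - a) (b - t)) has_integral Q / (\<alpha> + 1)) {a..m}"
  proof (rule has_integral_eq)
    show "((\<lambda>t. (t - a) powr \<alpha>) has_integral Q / (\<alpha> + 1)) {a..m}"
      using has_integral_powr_shift[of a a m "\<alpha> + 1"] assms m by (simp add: Q_def ma)
  qed (auto simp: powr_Suc m_def min_def field_simps)
  have right: "((\<lambda>t. (t - a) powr (\<alpha> - 1) * min (t - a) (b - t)) has_integral
      (b - a) * ((b - a) powr \<alpha> / \<alpha> - ((b - a) / 2) powr \<alpha> / \<alpha>) - (P / (\<alpha> + 1) - Q / (\<alpha> + 1))) {m..b}"
  proof (rule has_integral_eq)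
    show "((\<lambda>t. (b - a) * (t - a) powr (\<alpha> - 1) - (t - a) powr \<alpha>) has_integral
      (b - a) * ((b - a) powr \<alpha> / \<alpha> - ((b - a) / 2) powr \<alpha> / \<alpha>) - (P / (\<alpha> + 1) - Q / (\<alpha> + 1))) {m..b}"
      using has_integral_powr_shift[of a m b "\<alpha> + 1"] has_integral_powr_shift[of a m b \<alpha>] assms m
      by (intro has_integral_diff has_integral_mult_right) (simp_all add: P_def Q_def ma)
    fix t assume "t \<in> {m..b}"
    with m ma have "0 \<le> t - a" "min (t - a) (b - t) = (b - a) - (t - a)"
      by (auto simp: m_def min_def field_simps)
    then show "(b - a) * (t - a) powr (\<alpha> - 1) - (t - a) powr \<alpha>
        = (t - a) powr (\<alpha> - 1) * min (t - a) (b - t)"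
      by (simp only: powr_Suc) (simp add: algebra_simps)
  qed
  have P_eq: "(b - a) * (b - a) powr \<alpha> = P"
    using assms by (simp add: P_def powr_add)
  have Q_eq: "(b - a) * ((b - a) / 2) powr \<alpha> = 2 * Q"
    using assms by (simp add: Q_def powr_add)
  have total: "Q / (\<alpha> + 1) + ((b - a) * ((b - a) powr \<alpha> / \<alpha> - ((b - a) / 2) powr \<alpha> / \<alpha>)
      - (P / (\<alpha> + 1) - Q / (\<alpha> + 1))) = (P - 2 * Q) / (\<alpha> * (\<alpha> + 1))"
  proof -
    have "(b - a) * ((b - a) powr \<alpha> / \<alpha> - ((b - a) / 2) powr \<alpha> / \<alpha>) = P / \<alpha> - 2 * Q / \<alpha>"
      by (simp only: right_diff_distrib times_divide_eq_right P_eq Q_eq)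
    then show ?thesis
      using assms by (simp add: divide_simps) (simp add: algebra_simps)
  qed
  note whole = has_integral_combine[OF m left right, unfolded total]
  show "(\<lambda>t. (t - a) powr (\<alpha> - 1) * min (t - a) (b - t)) integrable_on {a..b}"
    using whole by blast
  \<comment> \<open>Here \<open>\<alpha> \<le> 1\<close> enters:
    \<open>2 powr (\<alpha> + 1) \<le> 4\<close> gives \<open>Q \<ge> P / 4\<close>.\<close>
  have "P = 2 powr (\<alpha> + 1) * Q"
    using assms by (simp add: P_def Q_def powr_divide)
  also have "\<dots> \<le> 4 * Q"
    using powr_mono[of "\<alpha> + 1" 2 "2::real"] assms by (intro mult_right_mono) (auto simp: Q_def)
  finally have "P - 2 * Q \<le> P / 2" by simp
  then have "(P - 2 * Q) / (\<alpha> * (\<alpha> + 1)) \<le> (P / 2) / (\<alpha> * (\<alpha> + 1))"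
    using assms by (intro divide_right_mono) auto
  with whole show "integral {a..b} (\<lambda>t. (t - a) powr (\<alpha> - 1) * min (t - a) (b - t))
           \<le> (b - a) powr (\<alpha> + 1) / (2 * \<alpha> * (\<alpha> + 1))"
    by (simp add: integral_unique P_def mult.assoc)
qed

section \<open>Riemann-Liouville integrals as gauge integrals\<close>

text \<open>The weight may blow up at \<open>a\<close> but is nonnegative and integrable, and
  \<open>g\<close> is bounded and measurable. Absolute integrability allows the passage from
  Lebesgue to gauge integrals.\<close>

lemma absolutely_integrable_powr_times_continuous:
  fixes a b \<alpha> :: real and g :: "real \<Rightarrow> real"
  assumes "a < b" "0 < \<alpha>" "continuous_on {a..b} g"
  shows "(\<lambda>t. (t - a) powr (\<alpha> - 1) * g t) absolutely_integrable_on {a..b}"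
proof -
  have "(\<lambda>t. (t - a) powr (\<alpha> - 1)) absolutely_integrable_on {a..b}"
    using has_integral_powr_shift[of a a b \<alpha>] assms
    by (intro nonnegative_absolutely_integrable_1) auto
  moreover have "g \<in> borel_measurable (lebesgue_on {a..b})"
    using assms by (intro continuous_imp_measurable_on_sets_lebesgue) auto
  moreover have "bounded (g ` {a..b})"
    using assms by (intro compact_imp_bounded compact_continuous_image) auto
  ultimately have "(\<lambda>t. g t * (t - a) powr (\<alpha> - 1)) absolutely_integrable_on {a..b}"
    by (intro absolutely_integrable_bounded_measurable_product_real) auto
  then show ?thesis by (simp add: mult.commute)
qed

lemma RL_right_eq_integral:
  fixes a b \<alpha> :: real
  assumes "a < b" "0 < \<alpha>" "continuous_on {a..b} f"
  shows "RL_right b \<alpha> f a = integral {a..b} (\<lambda>t. (t - a) powr (\<alpha> - 1) * f t) / Gamma \<alpha>"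
  using set_lebesgue_integral_eq_integral(2)[OF absolutely_integrable_powr_times_continuous[OF assms]] assms
  by (simp add: RL_right_def)

text \<open>The substitution of \<open>a + b - t\<close> for \<open>t\<close> moves the singularity
  from \<open>b\<close> to \<open>a\<close>, so that both fractional integrals carry the same
  weight.\<close>

lemma RL_left_eq_integral:
  fixes a b \<alpha> :: real
  assumes "a < b" "0 < \<alpha>" "continuous_on {a..b} f"
  shows "RL_left a \<alpha> f b = integral {a..b} (\<lambda>t. (t - a) powr (\<alpha> - 1) * f (a + b - t)) / Gamma \<alpha>"
proof -
  have "continuous_on {a..b} (\<lambda>t. f (a + b - t))"
    by (intro continuous_on_compose2[OF assms(3)] continuous_intros) auto
  note int = absolutely_integrable_powr_times_continuous[OF assms(1,2) this]
  have refl: "((\<lambda>t. (b - t) powr (\<alpha> - 1) * f t) has_integral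
      integral {a..b} (\<lambda>t. (t - a) powr (\<alpha> - 1) * f (a + b - t))) {a..b}"
    using has_integral_reflect_Icc[OF integrable_integral[OF set_lebesgue_integral_eq_integral(1)[OF int]]]
    by simp
  \<comment> \<open>Reflection gave only a gauge integral; identifying it with the Lebesgue integral
    in \<open>RL_left\<close> takes absolute integrability of the unreflected integrand.\<close>
  have "(\<lambda>t. f t * (b - t) powr (\<alpha> - 1)) absolutely_integrable_on {a..b}"
  proof (rule absolutely_integrable_bounded_measurable_product_real)
    have "((\<lambda>t. (b - t) powr (\<alpha> - 1)) has_integral (b - a) powr \<alpha> / \<alpha>) {a..b}"
      using has_integral_reflect_Icc[OF has_integral_powr_shift[of a a b \<alpha>]] assms by simp
    then show "(\<lambda>t. (b - t) powr (\<alpha> - 1)) absolutely_integrable_on {a..b}"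
      by (intro nonnegative_absolutely_integrable_1) auto
    show "f \<in> borel_measurable (lebesgue_on {a..b})"
      using assms by (intro continuous_imp_measurable_on_sets_lebesgue) auto
    show "bounded (f ` {a..b})"
      using assms by (intro compact_imp_bounded compact_continuous_image) auto
  qed auto
  then have "(\<lambda>t. (b - t) powr (\<alpha> - 1) * f t) absolutely_integrable_on {a..b}"
    by (simp add: mult.commute)
  from set_lebesgue_integral_eq_integral(2)[OF this] show ?thesis
    using assms refl by (simp add: RL_left_def integral_unique)
qed

section \<open>The trapezoid estimate for Lipschitz functions\<close>

lemma lipschitz_trapezoid_RL_bound:
  fixes a b \<alpha> M :: real and f :: "real \<Rightarrow> real"
  assumes ab: "a < b" and \<alpha>: "0 < \<alpha>" "\<alpha> \<le> 1"
    and lip: "\<And>x y. x \<in> {a..b} \<Longrightarrow> y \<in> {a..b} \<Longrightarrow> \<bar>f x - f y\<bar> \<le> M * \<bar>x - y\<bar>"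
  shows "\<bar>(f a + f b) / 2
           - Gamma (\<alpha> + 1) / (2 * (b - a) powr \<alpha>) * (RL_left a \<alpha> f b + RL_right b \<alpha> f a)\<bar>
         \<le> (b - a) * M / (2 * (\<alpha> + 1))"
proof -
  let ?w = "\<lambda>t. (t - a) powr (\<alpha> - 1)"
  define h where "h = b - a"
  have h: "h > 0" using ab by (simp add: h_def)
  have M: "M \<ge> 0"
    using lip[of a b] ab by (smt (verit) atLeastAtMost_iff mult_neg_pos)
  then have "M-lipschitz_on {a..b} f"
    using lip by (auto simp: lipschitz_on_def dist_real_def)
  then have cont: "continuous_on {a..b} f"
    by (rule lipschitz_on_continuous_on)
  have cont': "continuous_on {a..b} (\<lambda>t. f (a + b - t))"
    by (intro continuous_on_compose2[OF cont] continuous_intros) auto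
  note integrable = set_lebesgue_integral_eq_integral(1)[OF absolutely_integrable_powr_times_continuous[OF ab \<alpha>(1)]]
  define I1 where "I1 = integral {a..b} (\<lambda>t. ?w t * f t)"
  define I2 where "I2 = integral {a..b} (\<lambda>t. ?w t * f (a + b - t))"
  define D where "D t = f a + f b - f t - f (a + b - t)" for t
  \<comment> \<open>Since the weight has integral \<open>h powr \<alpha> / \<alpha>\<close>, the
    endpoint values can be brought under the integral, where they combine with \<open>f\<close> and
    its reflection to \<open>D\<close>.\<close>
  have "((\<lambda>t. (f a + f b) * ?w t - ?w t * f t - ?w t * f (a + b - t)) has_integral
      (f a + f b) * (h powr \<alpha> / \<alpha>) - I1 - I2) {a..b}"
    unfolding I1_def I2_def
    using has_integral_powr_shift[of a a b \<alpha>] ab \<alpha>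
    by (intro has_integral_diff has_integral_mult_right integrable_integral integrable cont cont')
       (simp_all add: h_def)
  then have hasD: "((\<lambda>t. ?w t * D t) has_integral (f a + f b) * (h powr \<alpha> / \<alpha>) - I1 - I2) {a..b}"
    by (rule has_integral_eq[rotated]) (simp add: D_def algebra_simps)
  have "\<bar>(f a + f b) * (h powr \<alpha> / \<alpha>) - I1 - I2\<bar>
      \<le> integral {a..b} (\<lambda>t. (2 * M) * (?w t * min (t - a) (b - t)))"
    unfolding integral_unique[OF hasD, symmetric] real_norm_def[symmetric]
  proof (rule integral_norm_bound_integral)
    show "(\<lambda>t. ?w t * D t) integrable_on {a..b}" using hasD by blast
    show "(\<lambda>t. (2 * M) * (?w t * min (t - a) (b - t))) integrable_on {a..b}"
      by (intro integrable_on_mult_right integral_powr_times_min(1) ab \<alpha>)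
    fix t assume t: "t \<in> {a..b}"
    \<comment> \<open>The four terms of \<open>D t\<close> can be paired in two ways:
      \<open>f a\<close> with \<open>f t\<close> gives differences over distance
      \<open>t - a\<close>, and \<open>f a\<close> with \<open>f (a + b - t)\<close> gives
      differences over distance \<open>b - t\<close>. Together they yield the minimum.\<close>
    have "\<bar>D t\<bar> \<le> \<bar>f a - f t\<bar> + \<bar>f b - f (a + b - t)\<bar>"
      by (simp add: D_def)
    also have "\<dots> \<le> M * (t - a) + M * (t - a)"
      using lip[of a t] lip[of b "a + b - t"] t by (intro add_mono) auto
    finally have 1: "\<bar>D t\<bar> \<le> 2 * M * (t - a)" by simp
    have "\<bar>D t\<bar> \<le> \<bar>f a - f (a + b - t)\<bar> + \<bar>f b - f t\<bar>"
      by (simp add: D_def)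
    also have "\<dots> \<le> M * (b - t) + M * (b - t)"
      using lip[of a "a + b - t"] lip[of b t] t by (intro add_mono) auto
    finally have "\<bar>D t\<bar> \<le> 2 * M * (b - t)" by simp
    with 1 have "\<bar>D t\<bar> \<le> 2 * M * min (t - a) (b - t)"
      by (simp add: min_def)
    then have "?w t * \<bar>D t\<bar> \<le> ?w t * (2 * M * min (t - a) (b - t))"
      by (intro mult_left_mono) auto
    then show "norm (?w t * D t) \<le> (2 * M) * (?w t * min (t - a) (b - t))"
      by (simp add: abs_mult mult_ac)
  qed
  also have "\<dots> \<le> (2 * M) * (h powr (\<alpha> + 1) / (2 * \<alpha> * (\<alpha> + 1)))"
    unfolding integral_mult_right h_def
    using M by (intro mult_left_mono integral_powr_times_min(2) ab \<alpha>) auto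
  finally have bound: "\<bar>(f a + f b) * (h powr \<alpha> / \<alpha>) - I1 - I2\<bar> 
      \<le> (2 * M) * (h powr (\<alpha> + 1) / (2 * \<alpha> * (\<alpha> + 1)))" .
  have "Gamma (\<alpha> + 1) / (2 * h powr \<alpha>) * (I2 / Gamma \<alpha> + I1 / Gamma \<alpha>)
      = \<alpha> / (2 * h powr \<alpha>) * (I1 + I2)"
  proof -
    have "Gamma (\<alpha> + 1) = \<alpha> * Gamma \<alpha>" "Gamma \<alpha> > 0"
      using \<alpha> Gamma_plus1[of \<alpha>] nonpos_Ints_nonpos[of \<alpha>] by (auto intro: Gamma_real_pos)
    then show ?thesis using h by (simp add: field_simps)
  qed
  then have "(f a + f b) / 2
      - Gamma (\<alpha> + 1) / (2 * (b - a) powr \<alpha>) * (RL_left a \<alpha> f b + RL_right b \<alpha> f a)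
      = \<alpha> / (2 * h powr \<alpha>) * ((f a + f b) * (h powr \<alpha> / \<alpha>) - I1 - I2)"
    using \<alpha> h by (simp add: RL_left_eq_integral[OF ab \<alpha>(1) cont] RL_right_eq_integral[OF ab \<alpha>(1) cont]
        flip: h_def I1_def I2_def) (simp add: field_simps)
  also have "\<bar>\<dots>\<bar> = \<alpha> / (2 * h powr \<alpha>) * \<bar>(f a + f b) * (h powr \<alpha> / \<alpha>) - I1 - I2\<bar>"
    using \<alpha> h by (simp add: abs_mult)
  also have "\<dots> \<le> \<alpha> / (2 * h powr \<alpha>) * ((2 * M) * (h powr (\<alpha> + 1) / (2 * \<alpha> * (\<alpha> + 1))))"
    using \<alpha> h by (intro mult_left_mono bound) auto
  also have "\<dots> = (b - a) * M / (2 * (\<alpha> + 1))"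
    using \<alpha> h by (simp add: powr_add flip: h_def)
  finally show ?thesis .
qed

text \<open>This is the weighted inequality of geometric and arithmetic means for
  \<open>\<alpha> * p + 1\<close> and \<open>1\<close>, with weights \<open>1 / p\<close> and
  \<open>1 - 1 / p\<close>.\<close>

lemma powr_Bernoulli_root:
  fixes \<alpha> p :: real
  assumes "\<alpha> \<ge> 0" "p \<ge> 1"
  shows "(\<alpha> * p + 1) powr (1 / p) \<le> \<alpha> + 1"
proof -
  have "(\<alpha> * p + 1) powr (1 / p) * 1 powr (1 - 1 / p) \<le> (1 / p) * (\<alpha> * p + 1) + (1 - 1 / p) * 1"
    using assms by (intro Youngs_inequality_0) (auto intro: add_nonneg_pos)
  also have "\<dots> = \<alpha> + 1"
    using assms by (simp add: field_simps)
  finally show ?thesis by simp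
qed

theorem theorem10:
  fixes A :: "real set" and \<eta> :: "real \<Rightarrow> real \<Rightarrow> real"
    and f :: "real \<Rightarrow> real" and a b p q \<alpha> :: real
  assumes "open A" and "invex_set A \<eta>"
    and "a \<in> A" and "b \<in> A" and "a < a + \<eta> b a"
    and "f differentiable_on A"
    and "deriv f absolutely_integrable_on {a..a + \<eta> b a}"
    and "q > 1" and "1 / p + 1 / q = 1"
    and "prequasiinvex_on A \<eta> (\<lambda>x. \<bar>deriv f x\<bar> powr q)"
    and "\<alpha> \<in> {0..1}"
  shows "\<bar>(f a + f (a + \<eta> b a)) / 2
           - Gamma (\<alpha> + 1) / (2 * (\<eta> b a) powr \<alpha>)
             * (RL_left a \<alpha> f (a + \<eta> b a) + RL_right (a + \<eta> b a) \<alpha> f a)\<bar>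
         \<le> \<eta> b a / (2 * (\<alpha> * p + 1) powr (1 / p))
             * (max (\<bar>deriv f a\<bar> powr q) (\<bar>deriv f b\<bar> powr q)) powr (1 / q)"
proof (cases "\<alpha> = 0")
  \<comment> \<open>For \<open>\<alpha> = 0\<close> both fractional integrals are endpoint values of
    \<open>f\<close>, and the left-hand side is zero.\<close>
  case True
  then show ?thesis
    using assms(5) by (simp add: RL_left_def RL_right_def add.commute)
next
  case False
  with assms have \<alpha>: "0 < \<alpha>" "\<alpha> \<le> 1" by auto
  define h where "h = \<eta> b a"
  define M where "M = (max (\<bar>deriv f a\<bar> powr q) (\<bar>deriv f b\<bar> powr q)) powr (1 / q)"
  have h: "h > 0" using assms(5) by (simp add: h_def)
  have seg: "x \<in> A \<and> \<bar>deriv f x\<bar> \<le> M" if x: "x \<in> {a..a + h}" for x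
  proof -
    define t where "t = (x - a) / h"
    have t: "t \<in> {0..1}" and xt: "x = a + t * \<eta> b a"
      using x h by (auto simp: t_def field_simps simp flip: h_def)
    have "\<bar>deriv f x\<bar> powr q \<le> max (\<bar>deriv f a\<bar> powr q) (\<bar>deriv f b\<bar> powr q)"
      using assms(3,4,10) t unfolding xt prequasiinvex_on_def by blast
    then have "(\<bar>deriv f x\<bar> powr q) powr (1 / q) \<le> M"
      unfolding M_def using assms(8) by (intro powr_mono2) auto
    moreover have "x \<in> A"
      using assms(2,3,4) t unfolding xt invex_set_def by blast
    ultimately show ?thesis
      using assms(8) by (simp add: powr_powr)
  qed
  have lip: "\<bar>f x - f y\<bar> \<le> M * \<bar>x - y\<bar>" if "x \<in> {a..a + h}" "y \<in> {a..a + h}" for x y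
  proof -
    have "norm (f x - f y) \<le> M * norm (x - y)"
    proof (rule field_differentiable_bound[OF _ _ _ that])
      fix z assume z: "z \<in> {a..a + h}"
      \<comment> \<open>Openness of \<open>A\<close> turns differentiability on \<open>A\<close>
        into differentiability at \<open>z\<close>, so \<open>deriv f z\<close> is the actual
        derivative.\<close>
      then have "f differentiable (at z)"
        using seg assms(1,6) by (auto simp: differentiable_on_eq_differentiable_at)
      then show "(f has_field_derivative deriv f z) (at z within {a..a + h})"
        by (metis DERIV_imp_deriv has_field_derivative_at_within real_differentiable_def)
      show "norm (deriv f z) \<le> M" using seg[OF z] by simp
    qed auto
    then show ?thesis by simp
  qed
  have p: "p \<ge> 1"
  proof -
    \<comment> \<open>Positivity of \<open>1 / p = 1 - 1 / q\<close> also rules out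
      \<open>p = 0\<close>, where division would return \<open>0\<close>.\<close>
    have "0 < 1 / q" "1 / q < 1"
      using assms(8) by auto
    then have "0 < 1 / p" "1 / p \<le> 1"
      using assms(9) by linarith+
    then show ?thesis by (simp add: field_simps split: if_splits)
  qed
  have "\<bar>(f a + f (a + h)) / 2
           - Gamma (\<alpha> + 1) / (2 * h powr \<alpha>) * (RL_left a \<alpha> f (a + h) + RL_right (a + h) \<alpha> f a)\<bar>
         \<le> h * M / (2 * (\<alpha> + 1))"
    using lipschitz_trapezoid_RL_bound[of a "a + h" \<alpha> f M] h \<alpha> lip by simp
  also have "\<dots> \<le> h * M / (2 * (\<alpha> * p + 1) powr (1 / p))"
  proof (rule divide_left_mono)
    show "2 * (\<alpha> * p + 1) powr (1 / p) \<le> 2 * (\<alpha> + 1)"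
      using powr_Bernoulli_root[of \<alpha> p] \<alpha> p by simp
    have "\<alpha> * p + 1 > 0" using \<alpha> p by (simp add: add_pos_pos)
    then show "0 < 2 * (\<alpha> + 1) * (2 * (\<alpha> * p + 1) powr (1 / p))"
      using \<alpha> by simp
    show "0 \<le> h * M" using h by (simp add: M_def)
  qed
  finally show ?thesis by (simp add: h_def M_def)
qed

end
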